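(* Let $p<q$ be primes and let $P(x)=I(\varGamma(\mathbb{Z}_{pq}),x)$. Then every complex zero $x$ of $P(x)$ lies in the open annular region $r_1<|x|<r_2$, where $$r_1=\frac{R-1}{R^{q-1}+R^{p-1}-2}\quad\text{and}\quad r_2=R+1,\quad\text{with}\quad R=2^{1/(q-p)}.$$
   Context: For a positive integer $n$, the zero divisor graph $\varGamma(\mathbb{Z}_n)$ is the simple undirected graph whose vertices are the non-zero zero divisors of the ring $\mathbb{Z}_n$ of integers modulo $n$ (non-zero $a$ such that $ab=0$ for some non-zero $b$), two distinct vertices $a,b$ being adjacent if and only if $ab=0$ in $\mathbb{Z}_n$. An independent set of a finite graph $G$ is a set of vertices no two of which are adjacent (the empty set included); $\alpha(G)$ is the maximum size of an independent set, and $s_k(G)$ is the number of independent sets of size $k$. The independence polynomial of $G$ is $I(G,x)=\sum_{k=0}^{\alpha(G)} s_k(G)x^k$. *)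

theory Defs
  imports Complex_Main "HOL-Number_Theory.Residues" "HOL-Computational_Algebra.Polynomial"
    "Graph_Theory.Pair_Digraph"
begin

text \<open>A simple undirected graph is rendered as a \<^locale>\<open>pair_graph\<close>: a finite, loop-free
  digraph without parallel arcs whose arc relation is symmetric, so that an edge between
  \<open>u\<close> and \<open>v\<close> is the pair of arcs \<open>(u, v)\<close> and \<open>(v, u)\<close>.\<close>

definition nonzero_zero_divisors :: "('a, 'm) ring_scheme \<Rightarrow> 'a set" where
  "nonzero_zero_divisors R =
    {a \<in> carrier R. a \<noteq> \<zero>\<^bsub>R\<^esub> \<and> (\<exists>b \<in> carrier R. b \<noteq> \<zero>\<^bsub>R\<^esub> \<and> a \<otimes>\<^bsub>R\<^esub> b = \<zero>\<^bsub>R\<^esub>)}"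

definition zero_divisor_graph :: "('a, 'm) ring_scheme \<Rightarrow> 'a pair_pre_digraph" where
  "zero_divisor_graph R =
    \<lparr> pverts = nonzero_zero_divisors R,
      parcs = {(a, b). a \<in> nonzero_zero_divisors R \<and> b \<in> nonzero_zero_divisors R \<and>
        a \<noteq> b \<and> a \<otimes>\<^bsub>R\<^esub> b = \<zero>\<^bsub>R\<^esub>} \<rparr>"

lemma pair_graph_zero_divisor_graph:
  assumes "cring R" and "finite (carrier R)"
  shows "pair_graph (zero_divisor_graph R)"
proof -
  interpret cring R by fact
  have fin: "finite (nonzero_zero_divisors R)"
    using assms(2) by (simp add: nonzero_zero_divisors_def)
  moreover have "parcs (zero_divisor_graph R) \<subseteq>
      nonzero_zero_divisors R \<times> nonzero_zero_divisors R"
    by (auto simp: zero_divisor_graph_def)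
  ultimately have "finite (parcs (zero_divisor_graph R))"
    by (meson finite_SigmaI finite_subset)
  with fin show ?thesis
    by unfold_locales
      (simp_all add: zero_divisor_graph_def symmetric_def with_proj_simps sym_def
        nonzero_zero_divisors_def split: prod.splits, auto simp: m_comm)
qed

definition independent_set :: "'a pair_pre_digraph \<Rightarrow> 'a set \<Rightarrow> bool" where
  "independent_set G S \<longleftrightarrow>
    S \<subseteq> pverts G \<and> (\<forall>u \<in> S. \<forall>v \<in> S. u \<noteq> v \<longrightarrow> (u, v) \<notin> parcs G)"

definition independence_number :: "'a pair_pre_digraph \<Rightarrow> nat" where
  "independence_number G = Max (card ` {S. independent_set G S})"

definition num_independent_sets :: "'a pair_pre_digraph \<Rightarrow> nat \<Rightarrow> nat" where
  "num_independent_sets G k = card {S. independent_set G S \<and> card S = k}"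

text \<open>The coefficients are natural numbers; the coefficient semiring is left open so that the
  polynomial can be used directly over the complex numbers.\<close>

definition independence_poly :: "'a pair_pre_digraph \<Rightarrow> 'b::comm_semiring_1 poly" where
  "independence_poly G =
    (\<Sum>k = 0..independence_number G. monom (of_nat (num_independent_sets G k)) k)"

end

theory Submission
  imports Defs
begin

text \<open>The graph is complete bipartite, its parts being the non-zero multiples of \<open>p\<close> and of \<open>q\<close>,
  so \<open>P(x) = (1 + x)\<^sup>p\<^sup>-\<^sup>1 + (1 + x)\<^sup>q\<^sup>-\<^sup>1 - 1\<close>. With \<open>y = 1 + x\<close> a zero satisfies
  \<open>y\<^sup>p\<^sup>-\<^sup>1 (y\<^sup>q\<^sup>-\<^sup>p + 1) = 1\<close>, whose left-hand side exceeds \<open>1\<close> in modulus as soon as \<open>\<bar>y\<bar> \<ge> R\<close>. Hence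
  \<open>\<bar>y\<bar> < R\<close>, which gives the upper bound. Dividing \<open>(y\<^sup>q\<^sup>-\<^sup>1 - 1) + (y\<^sup>p\<^sup>-\<^sup>1 - 1) = -1\<close> by \<open>y - 1 = x\<close>
  turns the left-hand side into geometric sums, which \<open>\<bar>y\<bar> < R\<close> bounds from above; this gives the
  lower bound.\<close>

text \<open>Grouping the independent sets by size eliminates the independence number, so only the
  family of independent sets has to be determined.\<close>

lemma poly_independence_poly:
  fixes x :: "'b::comm_semiring_1"
  assumes "finite (pverts G)"
  shows "poly (independence_poly G) x = (\<Sum>S | independent_set G S. x ^ card S)"
proof -
  let ?I = "{S. independent_set G S}"
  have fin: "finite ?I"
    by (rule finite_subset[of _ "Pow (pverts G)"]) (use assms in \<open>auto simp: independent_set_def\<close>)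
  have le: "card S \<le> independence_number G" if "S \<in> ?I" for S
    unfolding independence_number_def using fin that by (intro Max_ge) auto
  have "(\<Sum>S\<in>?I. x ^ card S) = (\<Sum>k = 0..independence_number G. \<Sum>S | S \<in> ?I \<and> card S = k. x ^ card S)"
    by (rule sum.group[symmetric]) (use fin le in auto)
  also have "\<dots> = (\<Sum>k = 0..independence_number G. of_nat (num_independent_sets G k) * x ^ k)"
    by (intro sum.cong refl) (simp add: num_independent_sets_def)
  finally show ?thesis
    by (simp add: independence_poly_def poly_sum poly_monom)
qed

text \<open>In the expansion of the product of \<open>x + 1\<close> over \<open>A\<close>, each
  subset \<open>S\<close> arises by choosing \<open>x\<close> on \<open>S\<close> and
  \<open>1\<close> elsewhere.\<close>

lemma sum_Pow_power_card:
  fixes x :: "'b::comm_semiring_1"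
  assumes "finite A"
  shows "(\<Sum>S\<in>Pow A. x ^ card S) = (1 + x) ^ card A"
  using prod_add[OF assms, of "\<lambda>_. x" "\<lambda>_. 1"] by (simp add: add.commute)

text \<open>An independent set cannot meet both parts, so it is a subset of one of them. The empty
  set is counted for both, whence the correction \<open>- 1\<close>.\<close>

lemma poly_independence_poly_complete_bipartite:
  fixes x :: "'b::comm_ring_1"
  assumes fin: "finite A" "finite B" and disj: "A \<inter> B = {}"
    and verts: "pverts G = A \<union> B" and arcs: "parcs G = A \<times> B \<union> B \<times> A"
  shows "poly (independence_poly G) x = (1 + x) ^ card A + (1 + x) ^ card B - 1"
proof -
  have "{S. independent_set G S} = Pow A \<union> Pow B"
    unfolding independent_set_def verts arcs using disj by fastforce
  then have "poly (independence_poly G) x = (\<Sum>S\<in>Pow A \<union> Pow B. x ^ card S)"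
    by (simp add: poly_independence_poly verts fin)
  also have "\<dots> = (\<Sum>S\<in>Pow A. x ^ card S) + (\<Sum>S\<in>Pow B. x ^ card S)
      - (\<Sum>S\<in>Pow A \<inter> Pow B. x ^ card S)"
    using fin by (intro sum_Un) auto
  also have "Pow A \<inter> Pow B = {{}}" using disj by auto
  finally show ?thesis by (simp add: sum_Pow_power_card fin)
qed

lemma card_multiples_less:
  fixes p q :: nat
  assumes "p > 0"
  shows "card {a :: int. 0 < a \<and> a < int (p * q) \<and> int p dvd a} = q - 1"
proof -
  have "bij_betw (\<lambda>k. int (p * k)) {1..<q} {a. 0 < a \<and> a < int (p * q) \<and> int p dvd a}"
    unfolding bij_betw_def
  proof
    show "inj_on (\<lambda>k. int (p * k)) {1..<q}" using assms by (auto simp: inj_on_def)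
    show "(\<lambda>k. int (p * k)) ` {1..<q} = {a. 0 < a \<and> a < int (p * q) \<and> int p dvd a}"
    proof (intro equalityI subsetI)
      fix a assume "a \<in> {a. 0 < a \<and> a < int (p * q) \<and> int p dvd a}"
      then obtain k where k: "0 < a" "a < int p * int q" "a = int p * k" by auto
      then have "0 < k" "k < int q" using assms by (auto simp: zero_less_mult_iff)
      then have "a = int (p * nat k)" "nat k \<in> {1..<q}" using k by auto
      then show "a \<in> (\<lambda>k. int (p * k)) ` {1..<q}" by blast
    qed (use assms in auto)
  qed
  then show ?thesis by (auto dest: bij_betw_same_card)
qed

lemma residue_ring_simps:
  "carrier (residue_ring m) = {0..m - 1}" "\<zero>\<^bsub>residue_ring m\<^esub> = 0"
  "a \<otimes>\<^bsub>residue_ring m\<^esub> b = a * b mod m"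
  by (simp_all add: residue_ring_def)

lemma poly_independence_poly_zero_divisor_graph:
  fixes p q :: nat and x :: "'b::comm_ring_1"
  assumes p: "prime p" and q: "prime q" and "p \<noteq> q"
  shows "poly (independence_poly (zero_divisor_graph (residue_ring (int (p * q))))) x =
    (1 + x) ^ (q - 1) + (1 + x) ^ (p - 1) - 1"
proof -
  define m where "m = int p * int q"
  define A where "A = {a :: int. 0 < a \<and> a < m \<and> int p dvd a}"
  define B where "B = {a :: int. 0 < a \<and> a < m \<and> int q dvd a}"
  have pq: "prime (int p)" "prime (int q)" "coprime (int p) (int q)"
    using assms by (auto simp: primes_coprime)
  have pos: "0 < int p" "0 < int q" using p q by (auto simp: prime_gt_0_nat)
  have fin: "finite A" "finite B"
    unfolding A_def B_def by (auto intro: finite_subset[of _ "{0..m}"])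
  have m_dvd: "m dvd a \<longleftrightarrow> int p dvd a \<and> int q dvd a" for a
    unfolding m_def using pq(3) by (auto intro: divides_mult dest: dvd_mult_left dvd_mult_right)
  \<comment> \<open>Otherwise \<open>m\<close>, the product of two coprime numbers, would divide a
    positive integer below \<open>m\<close>.\<close>
  have small: "\<not> (int p dvd a \<and> int q dvd a)" if "0 < a" "a < m" for a
    using that m_dvd zdvd_not_zless by blast
  have disj: "A \<inter> B = {}" using small unfolding A_def B_def by blast
  \<comment> \<open>If neither prime divided \<open>a\<close>, both would divide \<open>b\<close>,
    against \<open>small\<close>.\<close>
  have dvd_AB: "int p dvd a \<or> int q dvd a" if "0 < b" "b < m" "m dvd a * b" for a b
    using that small m_dvd pq(1,2) prime_dvd_mult_iff by metis
  have nzd: "nonzero_zero_divisors (residue_ring m) = A \<union> B"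
  proof (intro equalityI subsetI)
    fix a assume "a \<in> nonzero_zero_divisors (residue_ring m)"
    then obtain b where "0 < a" "a < m" "0 < b" "b < m" "m dvd a * b"
      unfolding nonzero_zero_divisors_def residue_ring_simps mem_Collect_eq mod_eq_0_iff_dvd
      by force
    then show "a \<in> A \<union> B" using dvd_AB by (auto simp: A_def B_def)
  next
    have "1 < int p" "1 < int q" using p q prime_gt_1_nat by auto
    then have "int p < m" "int q < m" by (auto simp: m_def)
    then have "int p \<in> {0..m - 1}" "int q \<in> {0..m - 1}" by auto
    moreover fix a assume a: "a \<in> A \<union> B"
    \<comment> \<open>The primes themselves serve as annihilators: \<open>q\<close> for the
      multiples of \<open>p\<close>, and \<open>p\<close> for the multiples of
      \<open>q\<close>.\<close>
    moreover from a have "m dvd a * int q \<or> m dvd a * int p"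
      unfolding m_dvd A_def B_def by auto
    ultimately have "\<exists>b\<in>{0..m - 1}. b \<noteq> 0 \<and> m dvd a * b"
      using pos by (metis less_irrefl)
    with a show "a \<in> nonzero_zero_divisors (residue_ring m)"
      unfolding nonzero_zero_divisors_def residue_ring_simps A_def B_def
      by (auto simp: mod_eq_0_iff_dvd)
  qed
  have arcs: "parcs (zero_divisor_graph (residue_ring m)) = A \<times> B \<union> B \<times> A"
  proof -
    \<comment> \<open>Two elements of the same part never multiply to zero: the other prime would
      divide one of them, against \<open>small\<close>.\<close>
    have "a \<noteq> b \<and> m dvd a * b \<longleftrightarrow> (a \<in> A \<and> b \<in> B) \<or> (a \<in> B \<and> b \<in> A)"
      if "a \<in> A \<union> B" "b \<in> A \<union> B" for a b
      using that small pq(1,2) disj unfolding m_dvd A_def B_def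
      by (auto simp: prime_dvd_mult_iff)
    then show ?thesis
      by (auto simp: zero_divisor_graph_def nzd residue_ring_simps mod_eq_0_iff_dvd)
  qed
  have "card A = q - 1" "card B = p - 1"
    using card_multiples_less[of p q] card_multiples_less[of q p] pos
    by (simp_all add: A_def B_def m_def mult.commute)
  moreover have "pverts (zero_divisor_graph (residue_ring m)) = A \<union> B"
    by (simp add: zero_divisor_graph_def nzd)
  moreover have "int (p * q) = m" by (simp add: m_def)
  ultimately show ?thesis
    by (simp only: poly_independence_poly_complete_bipartite[OF fin disj _ arcs])
qed

lemma cmod_less_of_power_add_power_eq_1:
  fixes y :: complex and R :: real
  assumes y: "y ^ b + y ^ a = 1" and "0 < a" "a < b" and R: "R ^ (b - a) = 2" "R > 1"
  shows "cmod y < R"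
proof (rule ccontr)
  assume "\<not> cmod y < R"
  then have ge: "cmod y \<ge> R" by simp
  have "2 \<le> cmod y ^ (b - a)" using power_mono[OF ge, of "b - a"] R by simp
  also have "\<dots> \<le> cmod (y ^ (b - a) + 1) + 1"
    using norm_triangle_ineq4[of "y ^ (b - a) + 1" 1] by (simp add: norm_power)
  finally have "1 \<le> cmod (y ^ (b - a) + 1)" by simp
  \<comment> \<open>The bound on the factor \<open>y ^ (b - a) + 1\<close> is not strict; strictness
    comes from \<open>y ^ a\<close>, where \<open>0 < a\<close> matters.\<close>
  moreover have "1 < cmod y ^ a" using ge R \<open>0 < a\<close> by (intro one_less_power) auto
  ultimately have "1 * 1 < cmod y ^ a * cmod (y ^ (b - a) + 1)"
    by (intro mult_less_le_imp_less) auto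
  also have "\<dots> = cmod (y ^ b + y ^ a)"
    using \<open>a < b\<close> by (simp add: norm_mult[symmetric] norm_power[symmetric] distrib_left power_add[symmetric])
  finally show False by (simp add: y)
qed

lemma cmod_gt_of_power_add_power_eq_1:
  fixes y :: complex and R :: real
  assumes y: "y ^ b + y ^ a = 1" and "cmod y < R" "R > 1" "b \<ge> 2"
  shows "(R - 1) / (R ^ b + R ^ a - 2) < cmod (y - 1)"
proof -
  \<comment> \<open>\<open>T\<close> is the value at \<open>R\<close> of the geometric sums left
    after dividing \<open>y ^ b - 1\<close> and \<open>y ^ a - 1\<close> by \<open>y - 1\<close>;
    the claimed lower bound is \<open>1 / T\<close>.\<close>
  define T where "T = (\<Sum>j<b. R ^ j) + (\<Sum>j<a. R ^ j)"
  have T: "(R - 1) * T = R ^ b + R ^ a - 2"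
    by (simp add: T_def distrib_left power_diff_1_eq[symmetric])
  have "(y - 1) * ((\<Sum>j<b. y ^ j) + (\<Sum>j<a. y ^ j)) = -1"
    unfolding distrib_left power_diff_1_eq[symmetric] using y by (simp add: algebra_simps)
  then have one: "cmod (y - 1) * cmod ((\<Sum>j<b. y ^ j) + (\<Sum>j<a. y ^ j)) = 1"
    by (metis norm_mult norm_minus_cancel norm_one)
  have "cmod ((\<Sum>j<b. y ^ j) + (\<Sum>j<a. y ^ j)) \<le> (\<Sum>j<b. cmod y ^ j) + (\<Sum>j<a. cmod y ^ j)"
    by (intro norm_triangle_mono) (auto intro!: sum_norm_le simp: norm_power)
  also have "\<dots> < T"
    unfolding T_def
  proof (intro add_less_le_mono sum_strict_mono_ex1 sum_mono)
    show "\<exists>j\<in>{..<b}. cmod y ^ j < R ^ j"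
      \<comment> \<open>The constant terms agree, so strictness is taken from the linear term, which
        is present because \<open>b \<ge> 2\<close>.\<close>
      using assms by (intro bexI[of _ 1]) auto
  qed (use assms in \<open>auto intro!: power_mono\<close>)
  finally have less: "cmod ((\<Sum>j<b. y ^ j) + (\<Sum>j<a. y ^ j)) < T" .
  have "0 < cmod (y - 1)" using one by (cases "y = 1") auto
  with one less have "1 < cmod (y - 1) * T" by (metis mult_strict_left_mono)
  moreover have "0 < T" using less norm_ge_zero le_less_trans by blast
  ultimately have "1 / T < cmod (y - 1)" by (simp add: divide_less_eq)
  then show ?thesis using \<open>R > 1\<close> by (simp add: T[symmetric])
qed

theorem theorem2p4:
  fixes p q :: nat and P :: "complex poly" and R r\<^sub>1 r\<^sub>2 :: real and x :: complex
  assumes "prime p" and "prime q" and "p < q"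
  defines "P \<equiv> independence_poly (zero_divisor_graph (residue_ring (int (p * q))))"
  defines "R \<equiv> 2 powr (1 / (real q - real p))"
  defines "r\<^sub>1 \<equiv> (R - 1) / (R ^ (q - 1) + R ^ (p - 1) - 2)"
  defines "r\<^sub>2 \<equiv> R + 1"
  assumes "poly P x = 0"
  shows "r\<^sub>1 < cmod x \<and> cmod x < r\<^sub>2"
proof -
  have p: "p \<ge> 2" using \<open>prime p\<close> by (rule prime_ge_2_nat)
  have y: "(1 + x) ^ (q - 1) + (1 + x) ^ (p - 1) = 1"
    using \<open>poly P x = 0\<close> assms(1-3)
    by (simp add: P_def poly_independence_poly_zero_divisor_graph del: of_nat_mult)
  have R1: "R > 1"
    unfolding R_def using \<open>p < q\<close> by (intro gr_one_powr) auto
  have "R ^ (q - p) = R powr (real q - real p)"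
    using R1 \<open>p < q\<close> by (simp add: powr_realpow[symmetric] of_nat_diff)
  also have "\<dots> = 2" using \<open>p < q\<close> by (simp add: R_def powr_powr)
  \<comment> \<open>The exponents are \<open>a = p - 1\<close> and \<open>b = q - 1\<close>, whose
    difference is still \<open>q - p\<close>; \<open>p \<ge> 2\<close> makes \<open>a\<close>
    positive, and \<open>p < q\<close> then gives \<open>b \<ge> 2\<close>.\<close>
  finally have "R ^ ((q - 1) - (p - 1)) = 2" using p by simp
  then have less: "cmod (1 + x) < R"
    using p \<open>p < q\<close> R1 by (intro cmod_less_of_power_add_power_eq_1[OF y]) auto
  have "r\<^sub>1 < cmod x"
    using cmod_gt_of_power_add_power_eq_1[OF y less R1] p \<open>p < q\<close> by (simp add: r\<^sub>1_def)
  moreover have "cmod x \<le> cmod (1 + x) + 1"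
    using norm_triangle_ineq4[of "1 + x" 1] by simp
  ultimately show ?thesis using less by (simp add: r\<^sub>2_def)
qed

end
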